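(* With the notation of the context, let $x^*\in\Delta$ satisfy $F(x^* )=\inf_{x\in\Delta}F(x)$. Then $f_{r_1}(x^* )=f_{r_2}(x^* )$ for all $r_1,r_2\in\mathcal{F}$.
   Context: Fix an integer $n\ge2$ and free generators $\xi_1,\dots,\xi_n$ of a free group; throughout $i,j,k\in\{1,\dots,n\}$ and $t,s,p\in\{-1,+1\}$. Let $\Psi$ be the set of reduced words $\xi_i^{2t}$; $\xi_i^t\xi_j^{2s}$ ($i\ne j$); $\xi_i^t\xi_j^s\xi_k^p$ ($i\ne j$, $j\ne k$). For a letter $\xi_a^x$ let $S(\xi_a^x)\subset\Psi$ be the set of words in $\Psi$ beginning with $\xi_a^x$, namely $\{\xi_a^{2x}\}\cup\{\xi_a^x\xi_j^{2s}\}\cup\{\xi_a^x\xi_j^s\xi_k^p\}$; for $a\ne b$ let $S(\xi_a^x\xi_b^y)=\{\xi_a^x\xi_b^{2y}\}\cup\{\xi_a^x\xi_b^y\xi_k^p: k\ne b\}$. A relation $r$ is a pair $(\psi_r,\Psi_r)$ with $\psi_r\in\Psi$, $\Psi_r\subseteq\Psi$. Let $\mathcal{F}$ be the collection of the following relations (indices $i_0\ne j_0$, in type 5a $i_0,j_0,k_0$ pairwise distinct, all signs arbitrary): 1a: $\psi_r=\xi_{i_0}^{2t_0}$, $\Psi_r=\Psi\setminus S(\xi_{i_0}^{t_0})$; 2b: $\psi_r=\xi_{i_0}^{t_0}\xi_{j_0}^{2s_0}$, $\Psi_r=\Psi\setminus S(\xi_{i_0}^{t_0}\xi_{j_0}^{s_0})$;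 3a: $\psi_r=\xi_{i_0}^{t_0}\xi_{j_0}^{s_0}\xi_{i_0}^{t_0}$, $\Psi_r=\Psi\setminus S(\xi_{j_0}^{s_0}\xi_{i_0}^{t_0})$; 4b: $\psi_r=\xi_{i_0}^{t_0}\xi_{j_0}^{s_0}\xi_{i_0}^{-t_0}$, $\Psi_r=S(\xi_{i_0}^{t_0})$; 5a: $\psi_r=\xi_{i_0}^{t_0}\xi_{j_0}^{s_0}\xi_{k_0}^{p_0}$, $\Psi_r=\Psi\setminus S(\xi_{j_0}^{s_0}\xi_{k_0}^{p_0})$. Let $\Delta=\{x\in\mathbb{R}^\Psi: x(\psi)>0\ \forall\psi,\ \sum_{\psi}x(\psi)=1\}$. For a relation $r$ and $x\in\Delta$ put $x_r=x(\psi_r)$, $X_r=\sum_{\psi\in\Psi_r}x(\psi)$, $f_r(x)=\frac{1-x_r}{x_r}\cdot\frac{1-X_r}{X_r}$, and $F(x)=\max_{r\in\mathcal{F}}f_r(x)$. *)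

theory Defs
  imports Complex_Main
begin

text \<open>A letter xi_i^t of the free group is encoded as the pair (i, t) with
  i in {1..n} and t in {-1, 1}; a word is the list of its letters.
  Thus xi_i^{2t} is [(i,t),(i,t)], xi_i^t xi_j^{2s} is [(i,t),(j,s),(j,s)].\<close>

type_synonym letter = "nat \<times> int"
type_synonym word = "letter list"

definition sgns :: "int set" where
  "sgns = {-1, 1}"

definition Psi :: "nat \<Rightarrow> word set" where
  "Psi n =
     {[(i,t),(i,t)] | i t. i \<in> {1..n} \<and> t \<in> sgns}
   \<union> {[(i,t),(j,s),(j,s)] | i t j s. i \<in> {1..n} \<and> j \<in> {1..n} \<and> i \<noteq> j \<and> t \<in> sgns \<and> s \<in> sgns}
   \<union> {[(i,t),(j,s),(k,p)] | i t j s k p. i \<in> {1..n} \<and> j \<in> {1..n} \<and> k \<in> {1..n}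
        \<and> i \<noteq> j \<and> j \<noteq> k \<and> t \<in> sgns \<and> s \<in> sgns \<and> p \<in> sgns}"

definition S1 :: "nat \<Rightarrow> nat \<Rightarrow> int \<Rightarrow> word set" where
  "S1 n a x = {w \<in> Psi n. take 1 w = [(a,x)]}"

definition S2 :: "nat \<Rightarrow> nat \<Rightarrow> int \<Rightarrow> nat \<Rightarrow> int \<Rightarrow> word set" where
  "S2 n a x b y = {w \<in> Psi n. take 2 w = [(a,x),(b,y)]}"

definition FF :: "nat \<Rightarrow> (word \<times> word set) set" where
  "FF n =
     {([(i,t),(i,t)], Psi n - S1 n i t) | i t. i \<in> {1..n} \<and> t \<in> sgns}
   \<union> {([(i,t),(j,s),(j,s)], Psi n - S2 n i t j s) | i t j s.
        i \<in> {1..n} \<and> j \<in> {1..n} \<and> i \<noteq> j \<and> t \<in> sgns \<and> s \<in> sgns}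
   \<union> {([(i,t),(j,s),(i,t)], Psi n - S2 n j s i t) | i t j s.
        i \<in> {1..n} \<and> j \<in> {1..n} \<and> i \<noteq> j \<and> t \<in> sgns \<and> s \<in> sgns}
   \<union> {([(i,t),(j,s),(i,-t)], S1 n i t) | i t j s.
        i \<in> {1..n} \<and> j \<in> {1..n} \<and> i \<noteq> j \<and> t \<in> sgns \<and> s \<in> sgns}
   \<union> {([(i,t),(j,s),(k,p)], Psi n - S2 n j s k p) | i t j s k p.
        i \<in> {1..n} \<and> j \<in> {1..n} \<and> k \<in> {1..n} \<and> i \<noteq> j \<and> j \<noteq> k \<and> i \<noteq> k
        \<and> t \<in> sgns \<and> s \<in> sgns \<and> p \<in> sgns}"

definition Delta :: "nat \<Rightarrow> (word \<Rightarrow> real) set" where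
  "Delta n = {x. (\<forall>w \<in> Psi n. x w > 0) \<and> (\<Sum>w \<in> Psi n. x w) = 1}"

definition frel :: "word \<times> word set \<Rightarrow> (word \<Rightarrow> real) \<Rightarrow> real" where
  "frel r x = (let xr = x (fst r); Xr = (\<Sum>w \<in> snd r. x w)
               in ((1 - xr) / xr) * ((1 - Xr) / Xr))"

definition FMax :: "nat \<Rightarrow> (word \<Rightarrow> real) \<Rightarrow> real" where
  "FMax n x = Max ((\<lambda>r. frel r x) ` FF n)"

end

theory Submission
  imports Defs
begin

text \<open>
  Each word \<open>w\<close> of \<open>\<Psi>\<close> carries exactly one relation, with set \<open>R w\<close>. At a minimiser of the
  maximum, with value \<open>F\<close>, Gordan's alternative yields multipliers \<open>\<nu> w \<ge> 0\<close>, not all zero and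
  supported on the active relations, such that \<open>\<mu> w + (\<Sum>u | w \<in> R u. \<nu> u)\<close> does not depend on
  \<open>w\<close>; here \<open>\<mu> w = \<nu> w * (1 + (F - 1) * X)\<^sup>2 / F\<close> with \<open>X\<close> the mass of \<open>R w\<close>. Comparing words with
  a common first letter \<open>a\<close> shows \<open>\<mu> [a, b, c] = \<mu> [a, a] + \<gamma>\<close> with \<open>\<gamma> \<ge> 0\<close> a sum of multipliers, so all
  relations are active once every \<open>\<mu> [a, a]\<close> is positive. The relations of type 4b force
  \<open>F \<ge> 6 * (2 * n - 2)\<close> and bound the mass of the words beginning with a given letter from below;
  hence the ratios \<open>\<mu> w / \<nu> w\<close> are so large that \<open>\<mu> [a, a] = 0\<close> is impossible.
\<close>

subsection \<open>Multipliers at a minimax point\<close>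

text \<open>Induction on the set of rows. A zero row \<open>k\<close> is itself a dependency.
  Otherwise the hypothesis is applied to the other rows projected along row \<open>k\<close>: a
  descent direction for the projections can be tilted to decrease row \<open>k\<close> as well, and
  a dependency among them exhibits a multiple of row \<open>k\<close> as a nonnegative combination
  of the others.\<close>

lemma gordan_alternative:
  fixes G :: "'i \<Rightarrow> 'w \<Rightarrow> real"
  assumes "finite I" "finite W"
  shows "(\<exists>v. \<forall>i\<in>I. (\<Sum>w\<in>W. G i w * v w) < 0) \<or>
    (\<exists>l. (\<forall>i\<in>I. l i \<ge> 0) \<and> (\<exists>i\<in>I. l i > 0) \<and> (\<forall>w\<in>W. (\<Sum>i\<in>I. l i * G i w) = 0))"
  using assms(1)
proof (induction I arbitrary: G)
  case empty
  then show ?case by simp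
next
  case (insert k K)
  define D where "D i v = (\<Sum>w\<in>W. G i w * v w)" for i v
  show ?case
  proof (cases "\<forall>w\<in>W. G k w = 0")
    case True
    define l where "l i = (if i = k then 1 else 0 :: real)" for i
    have "(\<Sum>i\<in>insert k K. l i * G i w) = 0" if "w \<in> W" for w
      using insert.hyps True that by (intro sum.neutral) (auto simp: l_def)
    moreover have "\<forall>i\<in>insert k K. l i \<ge> 0" "\<exists>i\<in>insert k K. l i > 0"
      by (auto simp: l_def)
    ultimately show ?thesis by blast
  next
    case False
    define u where "u w = - G k w" for w
    define p where "p = D k u"
    have D_comb: "D i (\<lambda>w. f w + c * g w) = D i f + c * D i g" for i f c g
      by (simp add: D_def algebra_simps sum.distrib sum_distrib_left)
    from False obtain w0 where w0: "w0 \<in> W" "G k w0 \<noteq> 0" by auto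
    have "(\<Sum>w\<in>W. G k w * G k w) > 0"
      using w0 assms(2) by (intro sum_pos2[of _ w0]) (auto simp: zero_less_mult_iff)
    then have p: "p < 0" by (simp add: p_def D_def u_def sum_negf)
    \<comment> \<open>As \<open>p\<close> is minus the squared norm of row \<open>k\<close>, this is
      the orthogonal projection of row \<open>i\<close> onto the complement of row
      \<open>k\<close>.\<close>
    define G' where "G' i w = G i w - (D i u / p) * G k w" for i w
    from insert.IH[of G'] show ?thesis
    proof
      assume "\<exists>v. \<forall>i\<in>K. (\<Sum>w\<in>W. G' i w * v w) < 0"
      then obtain v where v: "\<And>i. i \<in> K \<Longrightarrow> (\<Sum>w\<in>W. G' i w * v w) < 0" by blast
      define v' where "v' w = v w + (- (D k v / p)) * u w" for w
      have "D i v' = (\<Sum>w\<in>W. G' i w * v w)" for i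
      proof -
        have "D i v' = D i v - (D k v / p) * D i u"
          unfolding v'_def D_comb by simp
        moreover have "(\<Sum>w\<in>W. G' i w * v w) = D i v - (D i u / p) * D k v"
          unfolding G'_def D_def[of i v] D_def[of k v]
          by (simp add: algebra_simps sum_subtractf sum_distrib_left)
        ultimately show ?thesis by simp
      qed
      with v have neg: "D i v' < 0" if "i \<in> K" for i using that by simp
      have zero: "D k v' = 0"
        using p unfolding v'_def D_comb by (simp add: p_def)
      \<comment> \<open>The strict inequalities for \<open>K\<close> survive a small step along
        \<open>u\<close>, while \<open>D k\<close> moves from 0 to \<open>e * p < 0\<close>.\<close>
      have "\<forall>i\<in>K. eventually (\<lambda>e. D i v' + e * D i u < 0) (at_right 0)"
      proof
        fix i assume "i \<in> K"
        have "((\<lambda>e. D i v' + e * D i u) \<longlongrightarrow> D i v' + 0 * D i u) (at_right 0)"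
          by (intro tendsto_intros)
        then show "eventually (\<lambda>e. D i v' + e * D i u < 0) (at_right 0)"
          using neg[OF \<open>i \<in> K\<close>] by (auto dest: order_tendstoD(2))
      qed
      then have "eventually (\<lambda>e. \<forall>i\<in>K. D i v' + e * D i u < 0) (at_right 0)"
        using insert.hyps by (simp add: eventually_ball_finite)
      then have "eventually (\<lambda>e. e > 0 \<and> (\<forall>i\<in>K. D i v' + e * D i u < 0)) (at_right 0)"
        using eventually_at_right_less[of "0::real"] by (auto elim: eventually_elim2)
      then obtain e where e: "e > 0" "\<forall>i\<in>K. D i v' + e * D i u < 0"
        using eventually_happens'[OF trivial_limit_at_right_real] by blast
      have "\<forall>i\<in>insert k K. D i (\<lambda>w. v' w + e * u w) < 0"
        using e zero p unfolding D_comb by (auto simp: p_def mult_pos_neg)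
      then show ?thesis unfolding D_def by (intro disjI1 exI)
    next
      assume "\<exists>l. (\<forall>i\<in>K. l i \<ge> 0) \<and> (\<exists>i\<in>K. l i > 0) \<and> (\<forall>w\<in>W. (\<Sum>i\<in>K. l i * G' i w) = 0)"
      then obtain l i0 where l: "\<And>i. i \<in> K \<Longrightarrow> l i \<ge> 0" "i0 \<in> K" "l i0 > 0"
        "\<And>w. w \<in> W \<Longrightarrow> (\<Sum>i\<in>K. l i * G' i w) = 0" by blast
      define c where "c = (\<Sum>i\<in>K. l i * (D i u / p))"
      have comb: "(\<Sum>i\<in>K. l i * G i w) = c * G k w" if "w \<in> W" for w
        using l(4)[OF that]
        by (simp add: G'_def c_def algebra_simps sum_subtractf sum_distrib_left)
      have ext: "(\<Sum>i\<in>insert k K. (h(k := b)) i * G i w) = b * G k w + (\<Sum>i\<in>K. h i * G i w)"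
        for h b w
      proof -
        have "(\<Sum>i\<in>K. (h(k := b)) i * G i w) = (\<Sum>i\<in>K. h i * G i w)"
          using insert.hyps by (intro sum.cong) auto
        then show ?thesis using insert.hyps by simp
      qed
      show ?thesis
      proof (cases "c \<le> 0")
        case True
        have "\<forall>i\<in>insert k K. (l(k := - c)) i \<ge> 0" "\<exists>i\<in>insert k K. (l(k := - c)) i > 0"
          using l insert.hyps True by auto
        moreover have "\<forall>w\<in>W. (\<Sum>i\<in>insert k K. (l(k := - c)) i * G i w) = 0"
          unfolding ext using comb by simp
        ultimately show ?thesis by (intro disjI2 exI conjI)
      next
        case False
        \<comment> \<open>For \<open>c > 0\<close> the hypothesis is used again, now on the
          unprojected rows: row \<open>k\<close> is a positive multiple of a nonnegative nontrivial
          combination of them, so it decreases along any of their common descent directions.\<close>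
        from insert.IH[of G] show ?thesis
        proof
          assume "\<exists>v. \<forall>i\<in>K. (\<Sum>w\<in>W. G i w * v w) < 0"
          then obtain v where v: "\<And>i. i \<in> K \<Longrightarrow> D i v < 0" unfolding D_def by blast
          have "c * D k v = (\<Sum>w\<in>W. (\<Sum>i\<in>K. l i * G i w) * v w)"
            using comb by (simp add: D_def sum_distrib_left mult.assoc)
          also have "\<dots> = (\<Sum>i\<in>K. l i * D i v)"
            unfolding D_def sum_distrib_left sum_distrib_right
            by (subst sum.swap) (simp add: mult.assoc)
          also have "\<dots> < (\<Sum>i\<in>K. 0)"
            using l v insert.hyps
            by (intro sum_strict_mono_ex1) (auto simp: mult_le_0_iff mult_less_0_iff intro: less_imp_le)
          finally have "D k v < 0" using False by (simp add: mult_less_0_iff)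
          then show ?thesis using v unfolding D_def by blast
        next
          assume "\<exists>l. (\<forall>i\<in>K. l i \<ge> 0) \<and> (\<exists>i\<in>K. l i > 0) \<and> (\<forall>w\<in>W. (\<Sum>i\<in>K. l i * G i w) = 0)"
          then obtain h i1 where h: "\<And>i. i \<in> K \<Longrightarrow> h i \<ge> 0" "i1 \<in> K" "h i1 > 0"
            "\<And>w. w \<in> W \<Longrightarrow> (\<Sum>i\<in>K. h i * G i w) = 0" by blast
          have "\<forall>i\<in>insert k K. (h(k := 0)) i \<ge> 0" "\<exists>i\<in>insert k K. (h(k := 0)) i > 0"
            using h insert.hyps by (auto intro!: bexI[of _ i1])
          moreover have "\<forall>w\<in>W. (\<Sum>i\<in>insert k K. (h(k := 0)) i * G i w) = 0"
            unfolding ext using h by simp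
          ultimately show ?thesis by (intro disjI2 exI conjI)
        qed
      qed
    qed
  qed
qed

text \<open>The function f_r for the relation with word \<open>w\<close> and set \<open>R w\<close>,
  over an arbitrary index type, so that the multiplier argument is independent of the combinatorics
  of words.\<close>

definition displ :: "('w \<Rightarrow> 'w set) \<Rightarrow> ('w \<Rightarrow> real) \<Rightarrow> 'w \<Rightarrow> real" where
  "displ R x w = (1 - x w) / x w * ((1 - sum x (R w)) / sum x (R w))"

lemma DERIV_displ:
  fixes x v :: "'w \<Rightarrow> real"
  assumes "x w \<noteq> 0" "sum x (R w) \<noteq> 0"
  defines "X \<equiv> sum x (R w)"
  shows "((\<lambda>e. displ R (\<lambda>u. x u + e * v u) w) has_real_derivative
     - ((1 - X) / (x w ^ 2 * X) * v w + (1 - x w) / (x w * X ^ 2) * sum v (R w))) (at 0)"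
proof -
  have X: "X \<noteq> 0" using assms by simp
  have "sum (\<lambda>u. x u + e * v u) (R w) = X + e * sum v (R w)" for e
    by (simp add: X_def sum.distrib sum_distrib_left)
  then have eq: "(\<lambda>e. displ R (\<lambda>u. x u + e * v u) w) =
     (\<lambda>e. (1 - (x w + e * v w)) / (x w + e * v w) *
       ((1 - (X + e * sum v (R w))) / (X + e * sum v (R w))))"
    by (simp add: displ_def)
  show ?thesis unfolding eq
    using assms(1) X
    by (auto intro!: derivative_eq_intros simp: divide_simps)
       (simp add: algebra_simps power2_eq_square)
qed

text \<open>First-order optimality: without such multipliers Gordan's alternative supplies a
  direction that strictly decreases every active function, and a small step along it stays in the
  simplex and brings all functions below \<open>F\<close>.\<close>

lemma minimax_multipliers:
  fixes x :: "'w \<Rightarrow> real"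
  assumes W: "finite W" "W \<noteq> {}"
    and x: "\<And>w. w \<in> W \<Longrightarrow> 0 < x w" "\<And>w. w \<in> W \<Longrightarrow> x w < 1" "sum x W = 1"
    and X: "\<And>w. w \<in> W \<Longrightarrow> R w \<subseteq> W" "\<And>w. w \<in> W \<Longrightarrow> 0 < sum x (R w)"
      "\<And>w. w \<in> W \<Longrightarrow> sum x (R w) < 1"
    and F: "\<And>w. w \<in> W \<Longrightarrow> displ R x w \<le> F"
    and minimal: "\<And>y. (\<And>w. w \<in> W \<Longrightarrow> 0 < y w) \<Longrightarrow> sum y W = 1 \<Longrightarrow> \<exists>w\<in>W. F \<le> displ R y w"
  shows "\<exists>\<nu> c. (\<forall>w\<in>W. 0 \<le> \<nu> w) \<and> (\<exists>w\<in>W. 0 < \<nu> w) \<and>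
    (\<forall>w\<in>W. 0 < \<nu> w \<longrightarrow> displ R x w = F) \<and>
    (\<forall>w\<in>W. sum x (R w) * (1 - sum x (R w)) / (x w * (1 - x w)) * \<nu> w
        + (\<Sum>u\<in>{u\<in>W. w \<in> R u}. \<nu> u) = c)"
proof -
  define A where "A = {w\<in>W. displ R x w = F}"
  define a where "a u = (1 - sum x (R u)) / (x u ^ 2 * sum x (R u))" for u
  define b where "b u = (1 - x u) / (x u * sum x (R u) ^ 2)" for u
  have a: "a u > 0" if "u \<in> W" for u using x(1,2)[OF that] X(2,3)[OF that] by (simp add: a_def)
  have b: "b u > 0" if "u \<in> W" for u using x(1,2)[OF that] X(2,3)[OF that] by (simp add: b_def)
  have AW: "A \<subseteq> W" "finite A" using W by (auto simp: A_def)
  \<comment> \<open>\<open>None\<close> stands for the constraint on the total mass, relaxed to a strict inequality: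
    all functions decrease in \<open>x\<close>, so mass that is left over can be spread uniformly.\<close>
  define G where "G i w = (case i of None \<Rightarrow> 1
     | Some u \<Rightarrow> - (a u * of_bool (w = u) + b u * of_bool (w \<in> R u)))" for i w
  have G_Some: "(\<Sum>w\<in>W. G (Some u) w * v w) = - (a u * v u + b u * sum v (R u))"
    if "u \<in> W" for u v
  proof -
    have "(\<Sum>w\<in>W. of_bool (w = u) * v w) = v u"
      using that W by (simp add: of_bool_def if_distrib[of "\<lambda>c. c * _"] cong: if_cong)
    moreover have "(\<Sum>w\<in>W. of_bool (w \<in> R u) * v w) = sum v (R u)"
      using X(1)[OF that] W by (auto intro!: sum.mono_neutral_cong_right)
    ultimately show ?thesis
      by (simp add: G_def algebra_simps sum.distrib sum_negf sum_subtractf flip: sum_distrib_left)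
  qed
  have "finite (insert None (Some ` A))" using AW by simp
  from gordan_alternative[OF this W(1), of G] show ?thesis
  proof
    assume "\<exists>v. \<forall>i\<in>insert None (Some ` A). (\<Sum>w\<in>W. G i w * v w) < 0"
    then obtain v where v: "sum v W < 0" "\<And>u. u \<in> A \<Longrightarrow> a u * v u + b u * sum v (R u) > 0"
      using AW G_Some by (auto simp: G_def) (force simp: G_def)
    define t where "t = - sum v W / card W"
    have t: "t > 0" using v W by (simp add: t_def card_gt_0_iff divide_neg_pos)
    define v' where "v' w = v w + t" for w
    have sum_v': "sum v' W = 0" using W by (simp add: v'_def sum.distrib t_def sum_subtractf)
    have v': "a u * v' u + b u * sum v' (R u) > 0" if "u \<in> A" for u
    proof -
      have "a u * v' u + b u * sum v' (R u)
          = (a u * v u + b u * sum v (R u)) + (a u * t + b u * (card (R u) * t))"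
        by (simp add: v'_def sum.distrib algebra_simps)
      moreover have "a u * t + b u * (card (R u) * t) \<ge> 0"
        using a[of u] b[of u] t AW that by (intro add_nonneg_nonneg mult_nonneg_nonneg) auto
      ultimately show ?thesis using v(2)[OF that] by linarith
    qed
    have deriv: "((\<lambda>e. displ R (\<lambda>u. x u + e * v' u) w) has_real_derivative
        - (a w * v' w + b w * sum v' (R w))) (at 0)" if "w \<in> W" for w
      unfolding a_def b_def using x(1)[OF that] X(2)[OF that] by (intro DERIV_displ) auto
    have "\<forall>w\<in>W. eventually (\<lambda>e. displ R (\<lambda>u. x u + e * v' u) w < F) (at_right 0)"
    proof
      fix w assume w: "w \<in> W"
      show "eventually (\<lambda>e. displ R (\<lambda>u. x u + e * v' u) w < F) (at_right 0)"
      proof (cases "w \<in> A")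
        case True
        then have "- (a w * v' w + b w * sum v' (R w)) < 0" using v'[OF True] by linarith
        from DERIV_neg_dec_right[OF deriv[OF w] this] obtain d where
          "d > 0" "\<forall>h>0. h < d \<longrightarrow> displ R (\<lambda>u. x u + (0 + h) * v' u) w
              < displ R (\<lambda>u. x u + 0 * v' u) w" by blast
        then show ?thesis using True
          by (auto simp: eventually_at_right_field A_def intro!: exI[of _ d])
      next
        case False
        then have "displ R x w < F" using F[OF w] w by (auto simp: A_def)
        moreover have "((\<lambda>e. displ R (\<lambda>u. x u + e * v' u) w) \<longlongrightarrow> displ R (\<lambda>u. x u + 0 * v' u) w) (at_right 0)"
          using DERIV_isCont[OF deriv[OF w]] unfolding isCont_def
          by (rule tendsto_mono[rotated]) (simp add: at_le)
        ultimately show ?thesis by (auto dest: order_tendstoD(2))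
      qed
    qed
    moreover have "\<forall>w\<in>W. eventually (\<lambda>e. 0 < x w + e * v' w) (at_right 0)"
    proof
      fix w assume w: "w \<in> W"
      have "((\<lambda>e. x w + e * v' w) \<longlongrightarrow> x w + 0 * v' w) (at_right 0)"
        by (intro tendsto_intros)
      then show "eventually (\<lambda>e. 0 < x w + e * v' w) (at_right 0)"
        using x(1)[OF w] by (auto dest: order_tendstoD(1))
    qed
    ultimately have "eventually (\<lambda>e. (\<forall>w\<in>W. displ R (\<lambda>u. x u + e * v' u) w < F)
        \<and> (\<forall>w\<in>W. 0 < x w + e * v' w)) (at_right 0)"
      using W by (intro eventually_conj) (auto simp: eventually_ball_finite)
    then obtain e where e: "\<forall>w\<in>W. displ R (\<lambda>u. x u + e * v' u) w < F"
      "\<forall>w\<in>W. 0 < x w + e * v' w"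
      using eventually_happens'[OF trivial_limit_at_right_real] by blast
    have "sum (\<lambda>u. x u + e * v' u) W = 1"
      using x(3) sum_v' by (simp add: sum.distrib flip: sum_distrib_left)
    then show ?thesis using minimal[of "\<lambda>u. x u + e * v' u"] e by force
  next
    assume "\<exists>l. (\<forall>i\<in>insert None (Some ` A). l i \<ge> 0) \<and> (\<exists>i\<in>insert None (Some ` A). l i > 0)
      \<and> (\<forall>w\<in>W. (\<Sum>i\<in>insert None (Some ` A). l i * G i w) = 0)"
    then obtain l where l: "l None \<ge> 0" "\<And>u. u \<in> A \<Longrightarrow> l (Some u) \<ge> 0"
      "l None > 0 \<or> (\<exists>u\<in>A. l (Some u) > 0)"
      "\<And>w. w \<in> W \<Longrightarrow> (\<Sum>i\<in>insert None (Some ` A). l i * G i w) = 0" by auto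
    \<comment> \<open>Scaling by \<open>b u\<close> gives every membership term coefficient 1; the
      term of \<open>w\<close> itself then has coefficient \<open>a w / b w\<close>, which is the
      quotient in the conclusion.\<close>
    define \<nu> where "\<nu> u = (if u \<in> A then b u * l (Some u) else 0)" for u
    have nonneg: "\<nu> w \<ge> 0" if "w \<in> W" for w
      using that l b[OF that] by (auto simp: \<nu>_def intro!: mult_nonneg_nonneg)
    have main: "sum x (R w) * (1 - sum x (R w)) / (x w * (1 - x w)) * \<nu> w
        + (\<Sum>u\<in>{u\<in>W. w \<in> R u}. \<nu> u) = l None" if w: "w \<in> W" for w
    proof -
      have "(\<Sum>i\<in>insert None (Some ` A). l i * G i w) = l None
          - (\<Sum>u\<in>A. l (Some u) * (a u * of_bool (w = u))) - (\<Sum>u\<in>A. l (Some u) * (b u * of_bool (w \<in> R u)))"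
        using AW by (simp add: sum.reindex G_def algebra_simps sum.distrib sum_negf sum_subtractf)
      moreover have "(\<Sum>u\<in>A. l (Some u) * (a u * of_bool (w = u))) = (if w \<in> A then l (Some w) * a w else 0)"
        using AW by (simp add: of_bool_def if_distrib[of "\<lambda>c. _ * c"] cong: if_cong)
      moreover have "\<dots> = sum x (R w) * (1 - sum x (R w)) / (x w * (1 - x w)) * \<nu> w"
        using x(1,2)[OF w] X(2,3)[OF w]
        by (simp add: \<nu>_def a_def b_def divide_simps power2_eq_square)
      moreover have "(\<Sum>u\<in>A. l (Some u) * (b u * of_bool (w \<in> R u))) = (\<Sum>u\<in>{u\<in>W. w \<in> R u}. \<nu> u)"
        using AW W by (intro sum.mono_neutral_cong) (auto simp: \<nu>_def)
      ultimately show ?thesis using l(4)[OF w] by linarith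
    qed
    have "\<exists>w\<in>W. \<nu> w > 0"
    \<comment> \<open>If all \<open>\<nu>\<close> vanished, stationarity at one word would give
      \<open>l None = 0\<close>, so that no multiplier would be positive.\<close>
    proof (rule ccontr)
      assume "\<not> ?thesis"
      with nonneg have zero: "\<nu> w = 0" if "w \<in> W" for w using that by force
      from W obtain w where w: "w \<in> W" by auto
      have "l None = 0" using main[OF w] zero w by simp
      then obtain u where "u \<in> A" "l (Some u) > 0" using l by auto
      then have "\<nu> u > 0" using b[of u] AW by (auto simp: \<nu>_def)
      then show False using zero[of u] \<open>u \<in> A\<close> AW by auto
    qed
    then show ?thesis
      using nonneg main by (intro exI[of _ \<nu>] exI[of _ "l None"]) (auto simp: \<nu>_def A_def split: if_splits)
  qed
qed

subsection \<open>Words and their relations\<close>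

definition letters :: "nat \<Rightarrow> letter set" where
  "letters n = {1..n} \<times> sgns"

definition linv :: "letter \<Rightarrow> letter" where
  "linv a = (fst a, - snd a)"

definition starting :: "nat \<Rightarrow> word \<Rightarrow> word set" where
  "starting n p = {w \<in> Psi n. take (length p) w = p}"

text \<open>The type is read off the word: two letters give 1a, \<open>c = linv a\<close> gives 4b,
  and \<open>c = b\<close> gives 2b. Types 3a and 5a share the last branch, since both exclude the
  words beginning with the last two letters.\<close>

fun relset :: "nat \<Rightarrow> word \<Rightarrow> word set" where
  "relset n [a, b] = Psi n - starting n [a]"
| "relset n [a, b, c] =
    (if c = linv a then starting n [a]
     else if c = b then Psi n - starting n [a, b]
     else Psi n - starting n [b, c])"
| "relset n _ = {}"

text \<open>The words of the relations of type 4b, whose set is not a complement.\<close>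

definition conj_words :: "nat \<Rightarrow> letter \<Rightarrow> word set" where
  "conj_words n a = (\<lambda>b. [a, b, linv a]) ` {b \<in> letters n. fst b \<noteq> fst a}"

text \<open>The words whose relation is the complement of \<open>starting n [a, b]\<close>.\<close>

definition excluders :: "nat \<Rightarrow> letter \<Rightarrow> letter \<Rightarrow> word set" where
  "excluders n a b = insert [a, b, b] ((\<lambda>c. [c, a, b]) ` {c \<in> letters n. fst c \<noteq> fst a \<and> c \<noteq> linv b})"

text \<open>The words of types 1a, 2b, 3a and 5a, whose set is the complement of the words with a
  given prefix.\<close>

definition plain_words :: "nat \<Rightarrow> word set" where
  "plain_words n = Psi n - (\<Union>a\<in>letters n. conj_words n a)"

lemma linv_linv [simp]: "linv (linv a) = a" and fst_linv [simp]: "fst (linv a) = fst a"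
  by (simp_all add: linv_def)

lemma linv_eq_iff [simp]: "linv a = linv b \<longleftrightarrow> a = b"
  by (metis linv_linv)

lemma linv_in_letters [simp]: "linv a \<in> letters n \<longleftrightarrow> a \<in> letters n"
  by (cases a) (auto simp: letters_def linv_def sgns_def)

lemma linv_neq: "a \<in> letters n \<Longrightarrow> linv a \<noteq> a"
  by (cases a) (auto simp: letters_def linv_def sgns_def)

lemma same_index_iff:
  "\<lbrakk>a \<in> letters n; b \<in> letters n\<rbrakk> \<Longrightarrow> fst a = fst b \<longleftrightarrow> a = b \<or> a = linv b"
  by (cases a; cases b) (auto simp: letters_def linv_def sgns_def)

lemma finite_letters [simp]: "finite (letters n)" and card_letters: "card (letters n) = 2 * n"
  by (auto simp: letters_def sgns_def card_cartesian_product)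

text \<open>The two three-letter shapes merge: a last letter either equal to \<open>b\<close> or of
  another index is precisely a last letter that does not cancel \<open>b\<close>.\<close>

lemma Psi_eq:
  "Psi n = (\<lambda>a. [a, a]) ` letters n \<union>
    {[a, b, c] | a b c. a \<in> letters n \<and> b \<in> letters n \<and> c \<in> letters n \<and> fst a \<noteq> fst b \<and> c \<noteq> linv b}"
    (is "_ = ?A \<union> ?B")
proof
  show "Psi n \<subseteq> ?A \<union> ?B"
    by (auto simp: Psi_def letters_def linv_def sgns_def)
  have "?A \<subseteq> Psi n" by (auto simp: Psi_def letters_def)
  moreover have "[a, b, c] \<in> Psi n"
    if "a \<in> letters n" "b \<in> letters n" "c \<in> letters n" "fst a \<noteq> fst b" "c \<noteq> linv b" for a b c
  proof (cases "fst b = fst c")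
    case True
    then have "c = b" using that same_index_iff by metis
    then show ?thesis using that by (cases a; cases b) (auto simp: Psi_def letters_def)
  next
    case False
    then show ?thesis using that by (cases a; cases b; cases c) (auto simp: Psi_def letters_def)
  qed
  ultimately show "?A \<union> ?B \<subseteq> Psi n" by auto
qed

lemma double_in_Psi [simp]: "[a, b] \<in> Psi n \<longleftrightarrow> a \<in> letters n \<and> b = a"
  by (auto simp: Psi_eq)

lemma triple_in_Psi [simp]: "[a, b, c] \<in> Psi n \<longleftrightarrow>
    a \<in> letters n \<and> b \<in> letters n \<and> c \<in> letters n \<and> fst a \<noteq> fst b \<and> c \<noteq> linv b"
  unfolding Psi_eq by blast

lemma Psi_cases:
  assumes "w \<in> Psi n"
  obtains a where "w = [a, a]" "a \<in> letters n"
  | a b c where "w = [a, b, c]" "a \<in> letters n" "b \<in> letters n" "c \<in> letters n"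
      "fst a \<noteq> fst b" "c \<noteq> linv b"
  using assms by (auto simp: Psi_eq)

lemma finite_Psi [simp]: "finite (Psi n)"
proof (rule finite_subset)
  show "Psi n \<subseteq> {w. set w \<subseteq> letters n \<and> length w \<le> 3}"
    by (auto elim!: Psi_cases)
  show "finite {w. set w \<subseteq> letters n \<and> length w \<le> 3}"
    by (rule finite_lists_length_le) simp
qed

lemma starting_subset: "starting n p \<subseteq> Psi n"
  by (auto simp: starting_def)

lemma relset_subset: "relset n w \<subseteq> Psi n"
  by (induction n w rule: relset.induct) (auto simp: starting_def)

lemma S1_eq: "S1 n (fst a) (snd a) = starting n [a]"
  and S2_eq: "S2 n (fst a) (snd a) (fst b) (snd b) = starting n [a, b]"
  by (simp_all add: S1_def S2_def starting_def numeral_2_eq_2)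

text \<open>The third letter of a word is \<open>linv a\<close>, \<open>b\<close>, \<open>a\<close>
  or a letter of a third index; these cases are the types 4b, 2b, 3a and 5a, so the word determines
  its relation.\<close>

lemma FF_eq: "FF n = (\<lambda>w. (w, relset n w)) ` Psi n"
proof
  have S: "S1 n i t = starting n [(i,t)]" "S2 n i t j s = starting n [(i,t),(j,s)]" for i t j s
    using S1_eq[of n "(i,t)"] S2_eq[of n "(i,t)" "(j,s)"] by simp_all
  have sgn: "t \<in> sgns \<Longrightarrow> t \<noteq> - t \<and> - t \<in> sgns" for t by (auto simp: sgns_def)
  show "FF n \<subseteq> (\<lambda>w. (w, relset n w)) ` Psi n"
    unfolding FF_def S
    by (auto simp: image_iff Bex_def linv_def letters_def sgns_def)
  have "(w, relset n w) \<in> FF n" if "w \<in> Psi n" for w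
    using that
  proof (cases rule: Psi_cases)
    case (1 a)
    then show ?thesis by (cases a) (auto simp: FF_def S letters_def)
  next
    case (2 a b c)
    obtain i t j s k p where abc: "a = (i,t)" "b = (j,s)" "c = (k,p)"
      by (cases a; cases b; cases c) auto
    consider "c = linv a" | "c = b" | "c = a" | "k \<noteq> i" "k \<noteq> j"
      using 2 abc same_index_iff[of c n a] same_index_iff[of c n b] by auto
    then show ?thesis
      using 2 abc sgn[of t] by cases (auto simp: FF_def S letters_def linv_def)
  qed
  then show "(\<lambda>w. (w, relset n w)) ` Psi n \<subseteq> FF n" by auto
qed

lemma conj_words_subset: "a \<in> letters n \<Longrightarrow> conj_words n a \<subseteq> Psi n"
  by (auto simp: conj_words_def)

lemma plain_words_relset:
  assumes "w \<in> plain_words n"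
  obtains a p where "a \<in> letters n" "relset n w = Psi n - starting n (a # p)"
proof -
  have w: "w \<in> Psi n" "\<And>a. a \<in> letters n \<Longrightarrow> w \<notin> conj_words n a"
    using assms by (auto simp: plain_words_def)
  from w(1) show ?thesis
  proof (cases rule: Psi_cases)
    case (1 a)
    then show ?thesis using that[of a "[]"] by simp
  next
    case (2 a b c)
    then have "c \<noteq> linv a" using w(2)[of a] by (auto simp: conj_words_def)
    then show ?thesis using 2 that[of a "[b]"] that[of b "[c]"] by (cases "c = b") auto
  qed
qed

lemma conj_words_relset: "w \<in> conj_words n a \<Longrightarrow> relset n w = starting n [a]"
  by (auto simp: conj_words_def)

text \<open>The two-letter prefixes excluded by plain relations have distinct letters, so the only
  plain relation that omits \<open>[a, a]\<close> is its own.\<close>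

lemma mem_relset_double:
  assumes "a \<in> letters n"
  shows "{u \<in> Psi n. [a, a] \<in> relset n u} = (plain_words n - {[a, a]}) \<union> conj_words n a"
  using assms
  by (auto simp: plain_words_def conj_words_def starting_def image_iff
      elim!: Psi_cases split: if_splits)

text \<open>Compared with \<open>[a, a]\<close>, exactly the relations that exclude the prefix
  \<open>[a, b]\<close> are lost in addition. Subtracting the two stationarity equations therefore
  leaves only the multipliers of \<open>excluders n a b\<close>.\<close>

lemma mem_relset_triple:
  assumes "[a, b, c] \<in> Psi n"
  shows "{u \<in> Psi n. [a, b, c] \<in> relset n u} =
     (plain_words n - insert [a, a] (excluders n a b)) \<union> conj_words n a"
  using assms
  by (auto simp: plain_words_def conj_words_def starting_def image_iff excluders_def
      elim!: Psi_cases split: if_splits)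

lemma excluders_subset:
  assumes "a \<in> letters n" "b \<in> letters n" "fst a \<noteq> fst b"
  shows "excluders n a b \<subseteq> plain_words n"
  using assms linv_neq[OF assms(2)]
  by (auto simp: excluders_def plain_words_def conj_words_def)

lemma card_other_letters:
  assumes "a \<in> letters n"
  shows "card {b \<in> letters n. fst b \<noteq> fst a} = 2 * n - 2"
proof -
  have "{b \<in> letters n. fst b \<noteq> fst a} = letters n - {a, linv a}"
    using assms same_index_iff[of _ n a] by auto
  then show ?thesis
    using assms linv_neq[OF assms] by (simp add: card_Diff_subset card_letters)
qed

lemma card_conj_words: "a \<in> letters n \<Longrightarrow> card (conj_words n a) = 2 * n - 2"
  by (simp add: conj_words_def card_image inj_on_def card_other_letters)

text \<open>The word \<open>[a, b, b]\<close> takes the place of the omitted letter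
  \<open>linv b\<close>, so the count is that of the letters whose index differs from that of
  \<open>a\<close>.\<close>

lemma card_excluders:
  assumes "a \<in> letters n" "b \<in> letters n" "fst a \<noteq> fst b"
  shows "card (excluders n a b) \<le> 2 * n - 2"
proof -
  let ?C = "{c \<in> letters n. fst c \<noteq> fst a \<and> c \<noteq> linv b}"
  have "card (excluders n a b) \<le> Suc (card ((\<lambda>c. [c, a, b]) ` ?C))"
    unfolding excluders_def by (rule card_insert_le_m1) auto
  also have "card ((\<lambda>c. [c, a, b]) ` ?C) = card ?C"
    by (simp add: card_image inj_on_def)
  also have "Suc (card ?C) = card (insert (linv b) ?C)" by simp
  also have "insert (linv b) ?C = {c \<in> letters n. fst c \<noteq> fst a}" using assms by auto
  finally show ?thesis using card_other_letters[OF assms(1)] by simp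
qed

lemma sum_starting:
  fixes x :: "word \<Rightarrow> real"
  shows "(\<Sum>a\<in>letters n. sum x (starting n [a])) = sum x (Psi n)"
proof -
  have "starting n [a] = {w \<in> Psi n. hd w = a}" for a
    by (auto simp: starting_def elim!: Psi_cases)
  moreover have "hd ` Psi n \<subseteq> letters n" by (auto elim!: Psi_cases)
  ultimately show ?thesis
    using sum.group[of "Psi n" "letters n" hd x] by simp
qed

text \<open>Ensures that the mass of every relation set lies strictly between 0 and 1 on the
  simplex.\<close>

lemma relset_proper:
  assumes "w \<in> Psi n"
  shows "\<exists>u. u \<in> relset n w" "\<exists>u\<in>Psi n. u \<notin> relset n w"
proof -
  have "(\<exists>u. u \<in> relset n w) \<and> (\<exists>u\<in>Psi n. u \<notin> relset n w)"
    using assms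
  proof (cases rule: Psi_cases)
    case (1 a)
    then have "[linv a, linv a] \<in> relset n w" "[a, a] \<in> Psi n" "[a, a] \<notin> relset n w"
      using linv_neq[of a n] by (auto simp: starting_def)
    then show ?thesis by blast
  next
    case (2 a b c)
    note neq = linv_neq[OF 2(2)] linv_neq[OF 2(3)] linv_neq[OF 2(4)]
    consider "c = linv a" | "c \<noteq> linv a" "c = b" | "c \<noteq> linv a" "c \<noteq> b" by blast
    then show ?thesis
    proof cases
      case 1
      then have "[a, a] \<in> relset n w" "[linv a, linv a] \<in> Psi n" "[linv a, linv a] \<notin> relset n w"
        using 2 neq by (auto simp: starting_def)
      then show ?thesis by blast
    next
      case 2
      then have "[linv a, linv a] \<in> relset n w" "w \<in> Psi n" "w \<notin> relset n w"
        using \<open>w = _\<close> \<open>a \<in> _\<close> assms neq by (auto simp: starting_def)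
      then show ?thesis by blast
    next
      case 3
      then have "fst b \<noteq> fst c"
        using same_index_iff[of c n b] \<open>b \<in> _\<close> \<open>c \<in> _\<close> \<open>c \<noteq> linv b\<close> by auto
      then have "[linv b, linv b] \<in> relset n w" "[b, c, c] \<in> Psi n" "[b, c, c] \<notin> relset n w"
        using 3 2 neq by (auto simp: starting_def)
      then show ?thesis by blast
    qed
  qed
  then show "\<exists>u. u \<in> relset n w" "\<exists>u\<in>Psi n. u \<notin> relset n w" by blast+
qed

section \<open>Level inequalities for a single relation\<close>

lemma frel_relset: "frel (w, relset n w) x = displ (relset n) x w"
  by (simp add: frel_def displ_def Let_def)

lemma displ_le_iff:
  assumes "0 < x w" "0 < sum x (R w)"
  shows "displ R x w \<le> F \<longleftrightarrow> 1 - sum x (R w) \<le> x w * (1 + (F - 1) * sum x (R w))"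
proof -
  have "displ R x w \<le> F \<longleftrightarrow> (1 - x w) * (1 - sum x (R w)) \<le> F * (x w * sum x (R w))"
    using assms by (simp add: displ_def divide_le_eq)
  also have "\<dots> \<longleftrightarrow> 1 - sum x (R w) \<le> x w * (1 + (F - 1) * sum x (R w))"
    by (simp add: algebra_simps)
  finally show ?thesis .
qed

text \<open>At level \<open>F\<close> the factor \<open>1 + (F - 1) * X\<close> equals
  \<open>(1 - X) / x w\<close>. The stationarity coefficient thus depends on \<open>F\<close> and
  the mass \<open>X\<close> alone, and lower bounds for \<open>X\<close> become lower bounds for the
  coefficient.\<close>

lemma displ_level_ratio:
  assumes x: "0 < x w" "x w < 1" and X: "0 < sum x (R w)" "sum x (R w) < 1"
    and F: "displ R x w = F"
  shows "sum x (R w) * (1 - sum x (R w)) / (x w * (1 - x w)) = (1 + (F - 1) * sum x (R w))\<^sup>2 / F"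
proof -
  define y Y where "y = x w" and "Y = sum x (R w)"
  have y: "0 < y" "y < 1" "0 < Y" "Y < 1" using x X by (auto simp: y_def Y_def)
  have F': "F = (1 - y) * (1 - Y) / (y * Y)" using F by (simp add: displ_def y_def Y_def)
  have q: "1 + (F - 1) * Y = (1 - Y) / y"
    using y by (simp add: F' field_simps)
  have "Y * P / (y * p) = (P / y)\<^sup>2 / (p * P / (y * Y))" if "p \<noteq> 0" "P \<noteq> 0" for p P
    using y that by (simp add: divide_simps power2_eq_square)
  from this[of "1 - y" "1 - Y"] show ?thesis
    unfolding y_def[symmetric] Y_def[symmetric] q unfolding F' using y by simp
qed

subsection \<open>Lower bounds for the level\<close>

text \<open>If \<open>F < 6 * k\<close>, the right-hand side is at most 1/4 + 3k/8, whereas the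
  left-hand side is at least 3k/4.\<close>

lemma level_ge:
  fixes k X F :: real
  assumes "2 \<le> k" "0 < X" "X \<le> 1/4" "k * (1 - X) \<le> (1 + (F - 1) * X) * X"
  shows "6 * k \<le> F"
proof (rule ccontr)
  assume "\<not> ?thesis"
  then have "F * X\<^sup>2 \<le> 6 * k * X\<^sup>2" by (intro mult_right_mono) auto
  also have "X\<^sup>2 \<le> (1/4)\<^sup>2" using assms by (intro power_mono) auto
  then have "6 * k * X\<^sup>2 \<le> 6 * k * (1/4)\<^sup>2" using assms by (intro mult_left_mono) auto
  finally have "F * X\<^sup>2 \<le> 3/8 * k" by (simp add: power2_eq_square)
  moreover have "k * (3/4) \<le> k * (1 - X)" using assms by (intro mult_left_mono) auto
  moreover have "(1 + (F - 1) * X) * X = X - X\<^sup>2 + F * X\<^sup>2"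
    by (simp add: algebra_simps power2_eq_square)
  moreover have "X\<^sup>2 \<ge> 0" by simp
  ultimately show False using assms by linarith
qed

text \<open>With \<open>q = 1 + (F - 1) * X\<close>, multiplying the hypothesis by
  \<open>F - 1\<close> eliminates \<open>X\<close>: \<open>k * (F - q) \<le> q * (q - 1)\<close>. If
  \<open>q^2 < 2/3 * k * F\<close>, this gives \<open>F < 3 * q\<close>, hence
  \<open>F^2 \<le> 9 * q^2 < 6 * k * F \<le> F^2\<close>.\<close>

lemma level_square_ge:
  fixes k X F :: real
  assumes k: "2 \<le> k" and F: "6 * k \<le> F" and X: "0 < X"
    and *: "k * (1 - X) \<le> (1 + (F - 1) * X) * X"
  shows "2/3 * k * F \<le> (1 + (F - 1) * X)\<^sup>2"
proof (rule ccontr)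
  define q where "q = 1 + (F - 1) * X"
  assume "\<not> ?thesis"
  then have less: "q\<^sup>2 < 2/3 * k * F" by (simp add: q_def)
  have q: "q \<ge> 1" using k F X by (simp add: q_def)
  have "(F - 1) * (k * (1 - X)) \<le> (F - 1) * (q * X)"
    using * k F by (intro mult_left_mono) (auto simp: q_def)
  then have "k * (F - q) \<le> q * (q - 1)"
    by (simp add: q_def algebra_simps)
  then have "k * F \<le> q\<^sup>2 + k * q - q" by (simp add: algebra_simps power2_eq_square)
  with less q have "k * F < k * (3 * q)" by linarith
  then have "F < 3 * q" using k by simp
  then have "F * F \<le> (3 * q) * (3 * q)" using k F by (intro mult_mono) auto
  moreover have "6 * k * F \<le> F * F" using k F by (intro mult_right_mono) auto
  ultimately show False using less by (simp add: power2_eq_square)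
qed

section \<open>Bounds at a point of the simplex\<close>

context
  fixes n :: nat and x :: "word \<Rightarrow> real"
  assumes n: "n \<ge> 2" and x: "x \<in> Delta n"
begin

lemma x_pos: "w \<in> Psi n \<Longrightarrow> 0 < x w" and sum_x: "sum x (Psi n) = 1"
  using x by (auto simp: Delta_def)

lemma sum_less_one:
  assumes "A \<subseteq> Psi n" "u \<in> Psi n" "u \<notin> A"
  shows "sum x A < 1"
proof -
  have "sum x A < sum x (Psi n)"
    using assms x_pos by (intro sum_strict_mono2[of _ _ u]) (auto intro: less_imp_le)
  then show ?thesis by (simp add: sum_x)
qed

lemma x_less_one:
  assumes "w \<in> Psi n" shows "x w < 1"
proof -
  have "[(1,1),(1,1)] \<in> Psi n" "[(2,1),(2,1)] \<in> Psi n"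
    using n by (auto simp: letters_def sgns_def)
  then obtain u where "u \<in> Psi n" "u \<noteq> w"
    by (metis list.inject prod.inject numeral_eq_one_iff semiring_norm(85))
  then show ?thesis using sum_less_one[of "{w}" u] assms by simp
qed

lemma relset_sum:
  assumes "w \<in> Psi n"
  shows "0 < sum x (relset n w)" "sum x (relset n w) < 1"
proof -
  show "0 < sum x (relset n w)"
    using relset_proper(1)[OF assms] relset_subset[of n w] x_pos
    by (intro sum_pos) (auto intro: finite_subset)
  show "sum x (relset n w) < 1"
    using relset_proper(2)[OF assms] sum_less_one[OF relset_subset] by blast
qed

lemma starting_sum_pos:
  assumes "a \<in> letters n" shows "0 < sum x (starting n [a])"
proof (rule sum_pos2)
  show "[a, a] \<in> starting n [a]" using assms by (simp add: starting_def)
  show "0 < x [a, a]" using assms by (intro x_pos) simp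
qed (use x_pos starting_subset[of n "[a]"] in \<open>auto intro: finite_subset less_imp_le\<close>)

context
  fixes F :: real
  assumes F: "\<And>w. w \<in> Psi n \<Longrightarrow> displ (relset n) x w \<le> F"
begin

text \<open>Sum of the level inequalities of the \<open>2 * n - 2\<close> relations of type 4b with
  set \<open>starting n [a]\<close>. Their words lie in that same set, so their total mass is at
  most its mass.\<close>

lemma starting_sum_ineq:
  assumes a: "a \<in> letters n"
  shows "real (2 * n - 2) * (1 - sum x (starting n [a]))
    \<le> (1 + (F - 1) * sum x (starting n [a])) * sum x (starting n [a])"
proof -
  define X where "X = sum x (starting n [a])"
  have 1: "1 - X \<le> x w * (1 + (F - 1) * X)" if "w \<in> conj_words n a" for w
  proof -
    have "w \<in> Psi n" using conj_words_subset[OF a] that by auto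
    then show ?thesis
      using displ_le_iff[of x w "relset n" F] x_pos relset_sum(1)[of w] F conj_words_relset[OF that]
      by (auto simp: X_def)
  qed
  have sub: "conj_words n a \<subseteq> starting n [a]"
    using conj_words_subset[OF a] by (auto simp: starting_def conj_words_def)
  have fin: "finite (starting n [a])" using starting_subset by (rule finite_subset) simp
  have le: "sum x (conj_words n a) \<le> X"
    unfolding X_def using sub fin starting_subset[of n "[a]"] x_pos
    by (intro sum_mono2) (auto intro: less_imp_le)
  have "[linv a, linv a] \<in> Psi n" using a by auto
  then have "X < 1" unfolding X_def
    using sum_less_one[OF starting_subset, of "[linv a, linv a]" "[a]"] linv_neq[OF a]
    by (auto simp: starting_def)
  have "real (2 * n - 2) * (1 - X) = (\<Sum>w\<in>conj_words n a. 1 - X)"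
    by (simp only: sum_constant card_conj_words[OF a])
  also have "\<dots> \<le> (\<Sum>w\<in>conj_words n a. x w * (1 + (F - 1) * X))"
    by (intro sum_mono 1)
  also have "\<dots> = (1 + (F - 1) * X) * sum x (conj_words n a)"
    by (simp add: sum_distrib_right mult.commute)
  also have "\<dots> \<le> (1 + (F - 1) * X) * X"
  proof (intro mult_left_mono le)
    \<comment> \<open>No lower bound on \<open>F\<close> is available yet; the sign of the factor is
      read off one of the summed inequalities.\<close>
    have "conj_words n a \<noteq> {}" using card_conj_words[OF a] n by auto
    then obtain w where w: "w \<in> conj_words n a" by blast
    have "0 < x w * (1 + (F - 1) * X)" using 1[OF w] \<open>X < 1\<close> by linarith
    moreover have "0 < x w" using w conj_words_subset[OF a] x_pos by auto
    ultimately show "0 \<le> 1 + (F - 1) * X" by (simp add: zero_less_mult_iff)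
  qed
  finally show ?thesis by (simp add: X_def)
qed

text \<open>At least four first letters share total mass 1, so one of them carries at most
  1/4.\<close>

lemma level_lower: "6 * real (2 * n - 2) \<le> F"
proof -
  have "\<exists>a\<in>letters n. sum x (starting n [a]) \<le> 1/4"
  proof (rule ccontr)
    assume "\<not> ?thesis"
    then have *: "\<And>a. a \<in> letters n \<Longrightarrow> 1/4 < sum x (starting n [a])" by force
    have "letters n \<noteq> {}" using n by (auto simp: letters_def sgns_def)
    then have "(\<Sum>a\<in>letters n. 1/4) < (\<Sum>a\<in>letters n. sum x (starting n [a]))"
      using * by (intro sum_strict_mono) auto
    then show False using n by (simp add: sum_starting sum_x card_letters)
  qed
  then obtain a where "a \<in> letters n" "sum x (starting n [a]) \<le> 1/4" by blast
  then show ?thesis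
    using n starting_sum_pos starting_sum_ineq by (intro level_ge[of _ "sum x (starting n [a])"]) auto
qed

lemma conj_level:
  assumes "a \<in> letters n"
  shows "2/3 * real (2 * n - 2) * F \<le> (1 + (F - 1) * sum x (starting n [a]))\<^sup>2"
  using n starting_sum_pos[OF assms] starting_sum_ineq[OF assms] level_lower
  by (intro level_square_ge) auto

text \<open>The set of a plain relation contains all words beginning with any of at least three
  letters. By \<open>conj_level\<close> each of these contributes at least \<open>Q - 1\<close>, so
  the factor is at least \<open>3 * Q - 2 \<ge> 5/2 * Q\<close>, and 25/4 * 2/3 exceeds 3.\<close>

lemma plain_level:
  assumes "w \<in> plain_words n"
  shows "3 * real (2 * n - 2) * F \<le> (1 + (F - 1) * sum x (relset n w))\<^sup>2"
proof -
  define k where "k = real (2 * n - 2)"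
  define Q where "Q = sqrt (2/3 * k * F)"
  have k: "2 \<le> k" "6 * k \<le> F" using n level_lower by (auto simp: k_def)
  have kF: "0 \<le> 2/3 * k * F" using k by simp
  have Q2: "Q\<^sup>2 = 2/3 * k * F" using kF by (simp add: Q_def)
  \<comment> \<open>The bound \<open>Q \<ge> 4\<close> is what turns \<open>3 * Q - 2\<close> into
    \<open>5/2 * Q\<close>.\<close>
  have "4\<^sup>2 \<le> Q\<^sup>2"
  proof -
    have "2 * 12 \<le> k * F" using k by (intro mult_mono) auto
    then show ?thesis unfolding Q2 by (simp add: mult.commute)
  qed
  moreover have "0 \<le> Q" using kF by (simp add: Q_def)
  ultimately have Q: "4 \<le> Q" by (rule power2_le_imp_le)
  have Qle: "Q - 1 \<le> (F - 1) * sum x (starting n [e])" if "e \<in> letters n" for e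
  proof -
    have "0 \<le> 1 + (F - 1) * sum x (starting n [e])"
      using starting_sum_pos[OF that] k by (intro add_nonneg_nonneg mult_nonneg_nonneg) auto
    then have "Q \<le> 1 + (F - 1) * sum x (starting n [e])"
      unfolding Q_def k_def using conj_level[OF that] by (intro real_le_lsqrt) auto
    then show ?thesis by simp
  qed
  obtain a p where ap: "a \<in> letters n" "relset n w = Psi n - starting n (a # p)"
    using plain_words_relset[OF assms] .
  have "starting n (a # p) \<subseteq> starting n [a]"
    by (auto simp: starting_def elim!: Psi_cases)
  then have "Psi n - starting n [a] \<subseteq> relset n w" using ap by auto
  then have "sum x (Psi n - starting n [a]) \<le> sum x (relset n w)"
    using relset_subset[of n w] x_pos
    by (intro sum_mono2) (auto intro: finite_subset[OF relset_subset] less_imp_le)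
  moreover have "sum x (Psi n - starting n [a]) = sum x (Psi n) - sum x (starting n [a])"
    by (intro sum_diff starting_subset) simp
  moreover have "\<dots> = (\<Sum>e\<in>letters n - {a}. sum x (starting n [e]))"
    using ap by (simp add: sum_diff1 flip: sum_starting)
  ultimately have "(F - 1) * (\<Sum>e\<in>letters n - {a}. sum x (starting n [e])) \<le> (F - 1) * sum x (relset n w)"
    using k by (intro mult_left_mono) auto
  moreover have "real (card (letters n - {a})) * (Q - 1) \<le>
      (F - 1) * (\<Sum>e\<in>letters n - {a}. sum x (starting n [e]))"
    unfolding sum_constant[symmetric] sum_distrib_left[of "F - 1" "\<lambda>e. sum x (starting n [e])"]
    by (intro sum_mono Qle) auto
  moreover have "3 * (Q - 1) \<le> real (card (letters n - {a})) * (Q - 1)"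
    using n Q ap by (intro mult_right_mono) (auto simp: card_letters)
  ultimately have "3 * (Q - 1) \<le> (F - 1) * sum x (relset n w)" by (meson order_trans)
  then have "5/2 * Q \<le> 1 + (F - 1) * sum x (relset n w)" using Q by argo
  then have "(5/2 * Q)\<^sup>2 \<le> (1 + (F - 1) * sum x (relset n w))\<^sup>2"
    using Q by (intro power_mono) auto
  moreover have "3 * k * F \<le> (5/2 * Q)\<^sup>2"
    unfolding power_mult_distrib Q2 using kF by (simp add: power2_eq_square)
  ultimately show ?thesis by (simp add: k_def)
qed

text \<open>A positive multiplier forces its relation to be active, so it suffices that every
  \<open>\<mu> w\<close>, hence every \<open>\<nu> w\<close>, is positive.\<close>

lemma all_relations_active:
  assumes minimal: "\<And>y. y \<in> Delta n \<Longrightarrow> \<exists>w\<in>Psi n. F \<le> displ (relset n) y w"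
    and w: "w \<in> Psi n"
  shows "displ (relset n) x w = F"
proof -
  define k where "k = real (2 * n - 2)"
  have k: "2 \<le> k" "6 * k \<le> F" using n level_lower by (auto simp: k_def)
  have "Psi n \<noteq> {}" using w by auto
  have minimal': "\<exists>w\<in>Psi n. F \<le> displ (relset n) y w"
    if "\<And>w. w \<in> Psi n \<Longrightarrow> 0 < y w" "sum y (Psi n) = 1" for y
    using that by (intro minimal) (simp add: Delta_def)
  obtain \<nu> c where \<nu>: "\<And>w. w \<in> Psi n \<Longrightarrow> \<nu> w \<ge> 0" "\<exists>w\<in>Psi n. \<nu> w > 0"
    and active: "\<And>w. w \<in> Psi n \<Longrightarrow> \<nu> w > 0 \<Longrightarrow> displ (relset n) x w = F"
    and stationary: "\<And>w. w \<in> Psi n \<Longrightarrow>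
        sum x (relset n w) * (1 - sum x (relset n w)) / (x w * (1 - x w)) * \<nu> w
        + (\<Sum>u\<in>{u\<in>Psi n. w \<in> relset n u}. \<nu> u) = c"
    using minimax_multipliers[OF finite_Psi \<open>Psi n \<noteq> {}\<close> x_pos x_less_one sum_x relset_subset
      relset_sum F minimal'] by blast
  define \<mu> where "\<mu> w = sum x (relset n w) * (1 - sum x (relset n w)) / (x w * (1 - x w)) * \<nu> w" for w
  have \<mu>_nonneg: "0 \<le> \<mu> w" if "w \<in> Psi n" for w
    using \<nu>(1)[OF that] x_pos[OF that] x_less_one[OF that] relset_sum[OF that]
    by (simp add: \<mu>_def)
  have \<mu>_ge: "K * \<nu> w \<le> \<mu> w"
    if "w \<in> Psi n" "K * F \<le> (1 + (F - 1) * sum x (relset n w))\<^sup>2" for w K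
  proof (cases "\<nu> w > 0")
    case True
    have "K \<le> (1 + (F - 1) * sum x (relset n w))\<^sup>2 / F"
      using that k by (simp add: pos_le_divide_eq)
    also have "\<dots> = sum x (relset n w) * (1 - sum x (relset n w)) / (x w * (1 - x w))"
      using True that(1) x_pos x_less_one relset_sum active
      by (intro displ_level_ratio[symmetric]) auto
    finally show ?thesis unfolding \<mu>_def using True by (intro mult_right_mono) auto
  next
    case False
    then show ?thesis using \<nu>(1)[OF that(1)] by (simp add: \<mu>_def)
  qed
  have \<mu>_plain: "3 * k * \<nu> w \<le> \<mu> w" if "w \<in> plain_words n" for w
    using that plain_level[OF that] by (intro \<mu>_ge) (auto simp: k_def plain_words_def)
  have \<mu>_conj: "2/3 * k * \<nu> w \<le> \<mu> w" if "w \<in> conj_words n a" "a \<in> letters n" for w a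
    using that conj_level[OF that(2)] conj_words_subset[OF that(2)] conj_words_relset[OF that(1)]
    by (intro \<mu>_ge) (auto simp: k_def)
  \<comment> \<open>With \<open>\<mu>\<close> and \<open>\<nu>\<close> the (weighted) multipliers, stationarity becomes
    \<open>c - N = d a - \<nu> [a, a] + \<beta> a\<close> and \<open>\<mu> [a, b, e] = d a + \<gamma> a b\<close>, so it suffices to show
    \<open>d a > 0\<close>. Because \<open>\<nu>\<close> is much smaller than \<open>\<mu>\<close>, the \<open>\<gamma>\<close> are small compared with
    \<open>max d\<close>; if \<open>d a = 0\<close> then \<open>c - N = \<beta> a\<close> is too small for a letter maximising \<open>d\<close>.\<close>
  define N where "N = sum \<nu> (plain_words n)"
  define d where "d a = \<mu> [a, a]" for a
  define \<gamma> where "\<gamma> a b = sum \<nu> (excluders n a b)" for a b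
  define \<beta> where "\<beta> a = sum \<nu> (conj_words n a)" for a
  have fin: "finite (plain_words n)" by (simp add: plain_words_def)
  have fin_conj: "finite (conj_words n a)" if "a \<in> letters n" for a
    using conj_words_subset[OF that] by (rule finite_subset) simp
  have double_plain: "[a, a] \<in> plain_words n" if "a \<in> letters n" for a
    using that by (auto simp: plain_words_def conj_words_def)
  have disj: "plain_words n \<inter> conj_words n a = {}" if "a \<in> letters n" for a
    using that by (auto simp: plain_words_def)
  have eq_double: "d a + (N - \<nu> [a, a] + \<beta> a) = c" if a: "a \<in> letters n" for a
  proof -
    have "sum \<nu> {u \<in> Psi n. [a, a] \<in> relset n u} = sum \<nu> (plain_words n - {[a, a]}) + \<beta> a"
      unfolding mem_relset_double[OF a] \<beta>_def
      using fin fin_conj[OF a] disj[OF a] by (intro sum.union_disjoint) auto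
    also have "sum \<nu> (plain_words n - {[a, a]}) = N - \<nu> [a, a]"
      using fin double_plain[OF a] by (simp add: N_def sum_diff1)
    finally show ?thesis using stationary[of "[a, a]"] a by (simp add: d_def \<mu>_def)
  qed
  have eq_triple: "\<mu> [a, b, e] = d a + \<gamma> a b" if abe: "[a, b, e] \<in> Psi n" for a b e
  proof -
    have ab: "a \<in> letters n" "b \<in> letters n" "fst a \<noteq> fst b" using abe by auto
    have sub: "insert [a, a] (excluders n a b) \<subseteq> plain_words n"
      using excluders_subset[OF ab] double_plain[OF ab(1)] by auto
    have "[a, a] \<notin> excluders n a b" by (auto simp: excluders_def)
    then have "sum \<nu> (insert [a, a] (excluders n a b)) = \<nu> [a, a] + \<gamma> a b"
      using finite_subset[OF sub fin] by (simp add: \<gamma>_def)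
    moreover have "sum \<nu> {u \<in> Psi n. [a, b, e] \<in> relset n u} =
        sum \<nu> (plain_words n - insert [a, a] (excluders n a b)) + \<beta> a"
      unfolding mem_relset_triple[OF abe] \<beta>_def
      using fin fin_conj[OF ab(1)] disj[OF ab(1)] by (intro sum.union_disjoint) auto
    moreover have "sum \<nu> (plain_words n - insert [a, a] (excluders n a b)) =
        N - sum \<nu> (insert [a, a] (excluders n a b))"
      unfolding N_def using sub fin by (intro sum_diff)
    ultimately show ?thesis
      using stationary[OF abe] eq_double[OF ab(1)] by (simp add: \<mu>_def)
  qed
  define P where "P = {(a, b). a \<in> letters n \<and> b \<in> letters n \<and> fst a \<noteq> fst b}"
  have \<gamma>_nonneg: "0 \<le> \<gamma> a b" if "(a, b) \<in> P" for a b
    using that excluders_subset[of a n b] \<nu>(1) unfolding \<gamma>_def P_def plain_words_def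
    by (intro sum_nonneg) auto
  have d_nonneg: "0 \<le> d a" if "a \<in> letters n" for a
    using that \<mu>_nonneg by (simp add: d_def)
  have "finite P" by (rule finite_subset[of _ "letters n \<times> letters n"]) (auto simp: P_def)
  have "((1,1),(2,1)) \<in> P" using n by (auto simp: P_def letters_def sgns_def)
  then have "P \<noteq> {}" by auto
  then have "letters n \<noteq> {}" by (auto simp: P_def)
  define M where "M = Max (d ` letters n)"
  have "M \<in> d ` letters n" unfolding M_def using \<open>letters n \<noteq> {}\<close> by (intro Max_in) auto
  then obtain e where e: "e \<in> letters n" "d e = M" by auto
  have d_le: "d a \<le> M" if "a \<in> letters n" for a
    using that by (auto simp: M_def)
  define G where "G = Max (case_prod \<gamma> ` P)"
  have "G \<in> case_prod \<gamma> ` P" unfolding G_def using \<open>P \<noteq> {}\<close> \<open>finite P\<close> by (intro Max_in) auto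
  then obtain g h where gh: "(g, h) \<in> P" "\<gamma> g h = G" by auto
  have \<gamma>_le: "\<gamma> a b \<le> G" if "(a, b) \<in> P" for a b
  proof -
    have "\<gamma> a b \<in> case_prod \<gamma> ` P" using that by force
    then show ?thesis using \<open>finite P\<close> by (auto simp: G_def)
  qed
  have G: "0 \<le> G" "0 \<le> M" using \<gamma>_nonneg[OF gh(1)] gh(2) d_nonneg[OF e(1)] e(2) by auto
  have \<mu>_le: "\<mu> w \<le> M + G" if "w \<in> Psi n" for w
    using that
  proof (cases rule: Psi_cases)
    case (1 a)
    then show ?thesis using d_le[of a] G by (simp add: d_def)
  next
    case (2 a b c)
    then show ?thesis using eq_triple[of a b c] d_le[of a] \<gamma>_le[of a b] that by (auto simp: P_def)
  qed
  \<comment> \<open>The largest \<open>\<gamma>\<close> is a sum of at most \<open>k\<close> plain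
    multipliers, each at most \<open>(M + G) / (3 * k)\<close>; hence
    \<open>3 * G \<le> M + G\<close>.\<close>
  have "2 * G \<le> M"
  proof -
    have gh': "g \<in> letters n" "h \<in> letters n" "fst g \<noteq> fst h" using gh by (auto simp: P_def)
    have "3 * k * G = (\<Sum>w\<in>excluders n g h. 3 * k * \<nu> w)"
      by (simp add: \<gamma>_def sum_distrib_left flip: gh(2))
    also have "\<dots> \<le> (\<Sum>w\<in>excluders n g h. M + G)"
    proof (rule sum_mono)
      fix w assume "w \<in> excluders n g h"
      then have "w \<in> plain_words n" using excluders_subset[OF gh'] by auto
      then show "3 * k * \<nu> w \<le> M + G"
        using \<mu>_plain[of w] \<mu>_le[of w] by (simp add: plain_words_def)
    qed
    also have "\<dots> = real (card (excluders n g h)) * (M + G)" by simp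
    also have "\<dots> \<le> k * (M + G)"
      using card_excluders[OF gh'] G by (intro mult_right_mono) (auto simp: k_def)
    finally have "k * (3 * G) \<le> k * (M + G)" by (simp add: algebra_simps)
    then show ?thesis using k by simp
  qed
  have "M > 0"
  proof (rule ccontr)
    assume "\<not> M > 0"
    then have "M = 0" "G = 0" using G \<open>2 * G \<le> M\<close> by auto
    then have "\<mu> w \<le> 0" if "w \<in> Psi n" for w using \<mu>_le[OF that] by simp
    moreover obtain w where w: "w \<in> Psi n" "\<nu> w > 0" using \<nu> by blast
    moreover have "0 < \<mu> w" using w x_pos x_less_one relset_sum by (simp add: \<mu>_def)
    ultimately show False by force
  qed
  \<comment> \<open>If \<open>d a = 0\<close>, the \<open>k\<close> words of
    \<open>conj_words n a\<close> have \<open>\<mu> \<le> G\<close>, so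
    \<open>\<beta> a \<le> 3/2 * G \<le> 3/4 * M\<close>. At the maximising letter \<open>e\<close>,
    \<open>\<nu> [e, e] \<le> M / 6\<close> makes \<open>c - N\<close> at least
    \<open>5/6 * M\<close>, whereas at \<open>a\<close> it is at most
    \<open>\<beta> a\<close>.\<close>
  have d_pos: "0 < d a" if a: "a \<in> letters n" for a
  proof (rule ccontr)
    assume "\<not> 0 < d a"
    then have "d a = 0" using d_nonneg[OF a] by simp
    have "2/3 * k * \<beta> a = (\<Sum>w\<in>conj_words n a. 2/3 * k * \<nu> w)"
      by (simp add: \<beta>_def sum_distrib_left)
    also have "\<dots> \<le> (\<Sum>w\<in>conj_words n a. G)"
    proof (intro sum_mono)
      fix w assume w: "w \<in> conj_words n a"
      then obtain b where b: "w = [a, b, linv a]" "b \<in> letters n" "fst b \<noteq> fst a"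
        by (auto simp: conj_words_def)
      have "w \<in> Psi n" using conj_words_subset[OF a] w by auto
      then have "\<mu> w \<le> G"
        using eq_triple[of a b "linv a"] b \<open>d a = 0\<close> \<gamma>_le[of a b] a by (auto simp: P_def)
      then show "2/3 * k * \<nu> w \<le> G" using \<mu>_conj[OF w a] by simp
    qed
    also have "\<dots> = k * G" by (simp add: card_conj_words[OF a] k_def)
    finally have "k * (2/3 * \<beta> a) \<le> k * G" by (simp add: algebra_simps)
    then have "2/3 * \<beta> a \<le> G" using k by simp
    moreover have "\<nu> [a, a] \<ge> 0" using \<nu>(1) a by simp
    moreover have "\<beta> e \<ge> 0"
      unfolding \<beta>_def using conj_words_subset[OF e(1)] \<nu>(1) by (intro sum_nonneg) auto
    moreover have "6 * \<nu> [e, e] \<le> M"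
    proof -
      have "6 * \<nu> [e, e] \<le> 3 * k * \<nu> [e, e]" using k \<nu>(1) e by (intro mult_right_mono) auto
      then show ?thesis using \<mu>_plain[OF double_plain[OF e(1)]] e by (simp add: d_def)
    qed
    ultimately show False
      using eq_double[OF a] eq_double[OF e(1)] \<open>d a = 0\<close> e(2) \<open>2 * G \<le> M\<close> \<open>0 < M\<close> by linarith
  qed
  have "0 < \<mu> w"
    using w
  proof (cases rule: Psi_cases)
    case (1 a)
    then show ?thesis using d_pos by (simp add: d_def)
  next
    case (2 a b c)
    then show ?thesis using eq_triple[of a b c] w d_pos[of a] \<gamma>_nonneg[of a b] by (auto simp: P_def)
  qed
  then have "\<nu> w \<noteq> 0" by (auto simp: \<mu>_def)
  then show ?thesis using \<nu>(1)[OF w] active[OF w] by simp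
qed

end

end

section \<open>From the infimum of F to a common level\<close>

theorem theorem5p9:
  fixes n :: nat and xs :: "word \<Rightarrow> real"
  assumes "n \<ge> 2"
    and "xs \<in> Delta n"
    and "FMax n xs = (INF x \<in> Delta n. FMax n x)"
  shows "\<forall>r1 \<in> FF n. \<forall>r2 \<in> FF n. frel r1 xs = frel r2 xs"
proof -
  have FMax_eq: "FMax n x = Max ((\<lambda>w. displ (relset n) x w) ` Psi n)" for x
    by (simp add: FMax_def FF_eq image_image frel_relset)
  have "[(1,1),(1,1)] \<in> Psi n" using assms(1) by (simp add: letters_def sgns_def)
  then have ne: "Psi n \<noteq> {}" by (metis empty_iff)
  have le: "displ (relset n) x w \<le> FMax n x" if "w \<in> Psi n" for x w
    using that by (simp add: FMax_eq)
  \<comment> \<open>Nonnegativity bounds the values of \<open>FMax n\<close> below on the simplex,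
    so that \<open>INF\<close> is a genuine lower bound for them.\<close>
  have "0 \<le> FMax n y" if y: "y \<in> Delta n" for y
  proof -
    obtain w where w: "w \<in> Psi n" using ne by auto
    have "0 \<le> displ (relset n) y w"
      unfolding displ_def
      using x_pos[OF assms(1) y w] x_less_one[OF assms(1) y w] relset_sum[OF assms(1) y w]
      by simp
    then show ?thesis using le[OF w, of y] by linarith
  qed
  then have bdd: "bdd_below (FMax n ` Delta n)" by (intro bdd_belowI[of _ 0]) auto
  have minimal: "\<exists>w\<in>Psi n. FMax n xs \<le> displ (relset n) y w" if "y \<in> Delta n" for y
  proof -
    have "FMax n xs \<le> FMax n y" unfolding assms(3) using bdd that by (rule cINF_lower)
    moreover have "FMax n y \<in> displ (relset n) y ` Psi n"
      unfolding FMax_eq using ne by (intro Max_in) auto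
    ultimately show ?thesis by auto
  qed
  have "displ (relset n) xs w = FMax n xs" if "w \<in> Psi n" for w
    using all_relations_active[OF assms(1,2) le minimal that] .
  then show ?thesis by (auto simp: FF_eq frel_relset)
qed

end
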